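(* Let $G$ be a connected graph of order $n$ and diameter $d$. If $2^{d-3}\geq n-d$, then $\tau(G)\leq d$.
   Context: Graphs are finite, simple and undirected; the order of a graph is its number of vertices; $d_G(x,y)$ is the distance between $x$ and $y$ in $G$; the diameter is the maximum distance between two vertices. A vertex $w$ resolves a pair of vertices $u,v$ if $d_G(u,w)\neq d_G(v,w)$. A set $W\subseteq V(G)$ is a resolving set for $G$ if every pair of distinct vertices of $G$ is resolved by some vertex of $W$. The metric dimension $\beta(G)$ is the minimum cardinality of a resolving set for $G$ (with $\beta(K_1)=0$). The threshold dimension is $\tau(G)=\min\{\beta(H): H \text{ contains } G \text{ as a spanning subgraph}\}$, i.e. the minimum metric dimension among all graphs $H$ with $V(H)=V(G)$ and $E(G)\subseteq E(H)$. *)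

theory Defs
  imports "Graph_Theory.Graph_Theory"
begin

text \<open>
  A finite simple undirected graph is an \<^typ>\<open>'a pair_pre_digraph\<close> satisfying \<^const>\<open>pair_graph\<close>:
  finitely many vertices, no loops, and a symmetric arc relation, so that an edge
  $uv$ is represented by the two arcs $(u,v)$ and $(v,u)$.
\<close>

text \<open>Shortest-path cost with unit weights; it is \<open>\<infinity>\<close> for vertices in different components.\<close>

definition gdist :: "'a pair_pre_digraph \<Rightarrow> 'a \<Rightarrow> 'a \<Rightarrow> ereal" where
  "gdist G u v = wf_digraph.\<mu> (with_proj G) (\<lambda>_. 1) u v"

definition gdiameter :: "'a pair_pre_digraph \<Rightarrow> ereal" where
  "gdiameter G = Max {gdist G u v | u v. u \<in> pverts G \<and> v \<in> pverts G}"

definition resolves :: "'a pair_pre_digraph \<Rightarrow> 'a \<Rightarrow> 'a \<Rightarrow> 'a \<Rightarrow> bool" where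
  "resolves G w u v \<longleftrightarrow> gdist G u w \<noteq> gdist G v w"

definition resolving_set :: "'a pair_pre_digraph \<Rightarrow> 'a set \<Rightarrow> bool" where
  "resolving_set G W \<longleftrightarrow> W \<subseteq> pverts G \<and>
    (\<forall>u\<in>pverts G. \<forall>v\<in>pverts G. u \<noteq> v \<longrightarrow> (\<exists>w\<in>W. resolves G w u v))"

definition metric_dim :: "'a pair_pre_digraph \<Rightarrow> nat" where
  "metric_dim G = (LEAST k. \<exists>W. resolving_set G W \<and> card W = k)"

text \<open>\<^const>\<open>spanning\<close> takes the spanning subgraph as its first argument.\<close>

definition threshold_dim :: "'a pair_pre_digraph \<Rightarrow> nat" where
  "threshold_dim G =
    (LEAST k. \<exists>H. pair_graph H \<and> spanning (with_proj G) (with_proj H) \<and> metric_dim H = k)"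

lemma gdist_self:
  assumes "pair_graph G" "u \<in> pverts G"
  shows "gdist G u u = 0"
proof -
  interpret pair_graph G by fact
  have "\<mu> (\<lambda>_. 1) u u \<le> 0"
    using min_cost_le_walk_cost[of u "[]" u "\<lambda>_. 1"] assms(2)
    by (simp add: awalk_Nil_iff zero_ereal_def)
  moreover have "\<mu> (\<lambda>_. 1) u u \<ge> 0"
    unfolding \<mu>_def by (rule INF_greatest) (auto intro!: pos_cost_pos_awalk_cost)
  ultimately show ?thesis by (simp add: gdist_def)
qed

lemma gdist_neq_ge_1:
  assumes "pair_graph G" "u \<noteq> v"
  shows "gdist G u v \<ge> 1"
proof -
  interpret pair_graph G by fact
  have "1 \<le> ereal (awalk_cost (\<lambda>_. 1) p)" if "awalk u p v" for p
    using that assms(2) by (cases p) (auto simp: awalk_def awalk_cost_def sum_list_triv one_ereal_def)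
  then show ?thesis unfolding gdist_def \<mu>_def by (auto intro: INF_greatest)
qed

lemma resolving_set_pverts:
  assumes "pair_graph G"
  shows "resolving_set G (pverts G)"
proof -
  have "resolves G u u v" if "u \<in> pverts G" "u \<noteq> v" for u v
    using gdist_self[OF assms that(1)] gdist_neq_ge_1[OF assms, of v u] that(2)
    by (auto simp: resolves_def)
  then show ?thesis unfolding resolving_set_def by blast
qed

end

theory Submission
  imports Defs
begin

text \<open>
  Let \<open>v\<close> be an end of a diametral pair and let \<open>W\<close> consist of one vertex at each of the distances
  \<open>0, \<dots>, d - 1\<close> from \<open>v\<close>. Distances to \<open>v\<close> of adjacent vertices differ by at most one, so every vertex
  has at most three neighbours in \<open>W\<close>, and its neighbourhood in \<open>W\<close> has at least \<open>2 ^ (d - 3)\<close> supersets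
  within \<open>W\<close>. As there are at most that many vertices outside \<open>W\<close>, these supersets can be chosen
  pairwise distinct, greedily. Joining each vertex outside \<open>W\<close> to its chosen superset yields a graph
  in which any two vertices outside \<open>W\<close> have different neighbourhoods in \<open>W\<close>, so that \<open>W\<close> resolves it.
\<close>

text \<open>A crude form of Hall's theorem: when a new element is served, fewer than
  \<open>card A\<close> values are taken, so its own set still offers a fresh one.\<close>

lemma inj_choice_if_card_le:
  assumes "finite A" "\<And>a. a \<in> A \<Longrightarrow> finite (F a)" "\<And>a. a \<in> A \<Longrightarrow> card A \<le> card (F a)"
  shows "\<exists>f. inj_on f A \<and> (\<forall>a\<in>A. f a \<in> F a)"
  using assms
proof (induction A rule: finite_induct)
  case (insert x A)
  then obtain f where f: "inj_on f A" "\<forall>a\<in>A. f a \<in> F a"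
    by (metis card_insert_disjoint insertCI Suc_leD)
  have "card (f ` A) < card (F x)"
    using insert.prems(2)[of x] insert.hyps card_image_le[of A f] by simp
  then obtain y where y: "y \<in> F x" "y \<notin> f ` A"
    by (meson card_mono finite_imageI insert.hyps(1) linorder_not_less subsetI)
  have "inj_on (f(x := y)) (insert x A)" "\<forall>a\<in>insert x A. (f(x := y)) a \<in> F a"
    using f y insert.hyps by (auto simp: inj_on_def)
  then show ?case by blast
qed simp

lemma card_supersets:
  assumes "finite W" "N \<subseteq> W"
  shows "card {S. N \<subseteq> S \<and> S \<subseteq> W} = 2 ^ (card W - card N)"
proof -
  have "bij_betw (\<lambda>T. T \<union> N) (Pow (W - N)) {S. N \<subseteq> S \<and> S \<subseteq> W}"
    using assms by (intro bij_betw_byWitness[where f' = "\<lambda>S. S - N"]) auto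
  then show ?thesis
    using assms by (simp add: bij_betw_same_card[symmetric] card_Pow card_Diff_subset finite_subset)
qed

context pair_graph
begin

lemma awalk_cost_unit: "awalk_cost (\<lambda>_. 1) p = real (length p)"
  by (induction p) auto

text \<open>Adjacency is the only information about distances in the enlarged graph that the
  argument controls; this turns different neighbourhoods into different distances.\<close>

lemma gdist_eq_1_iff:
  assumes "u \<noteq> v"
  shows "gdist G u v = 1 \<longleftrightarrow> (u, v) \<in> parcs G"
proof
  assume uv: "(u, v) \<in> parcs G"
  then have "awalk u [(u, v)] v"
    by (auto simp: awalk_Cons_iff awalk_Nil_iff in_arcsD2)
  from min_cost_le_walk_cost[OF this, of "\<lambda>_. 1"] have "gdist G u v \<le> 1"
    by (simp add: gdist_def one_ereal_def)
  then show "gdist G u v = 1"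
    using gdist_neq_ge_1[OF pair_graph_axioms assms] by order
next
  assume eq: "gdist G u v = 1"
  show "(u, v) \<in> parcs G"
  proof (rule ccontr)
    assume "(u, v) \<notin> parcs G"
    have "2 \<le> length p" if "awalk u p v" for p
      using that assms \<open>(u, v) \<notin> parcs G\<close>
      by (cases p; cases "tl p") (auto simp: awalk_Cons_iff awalk_Nil_iff)
    then have "2 \<le> gdist G u v"
      unfolding gdist_def \<mu>_def by (auto intro!: INF_greatest simp: awalk_cost_unit)
    with eq show False by simp
  qed
qed

text \<open>Unit costs admit no negative cycle, so a finite infimum is attained by a path, whose
  cost is its length.\<close>

lemma gdist_nat:
  assumes "gdist G u v < \<infinity>"
  shows "\<exists>k::nat. gdist G u v = ereal (real k)"
proof -
  have "u \<rightarrow>\<^sup>*\<^bsub>with_proj G\<^esub> v"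
    using assms by (simp only: gdist_def \<mu>_reach_conv)
  then obtain p where "\<mu> (\<lambda>_. 1) u v = awalk_cost (\<lambda>_. 1) p"
    using no_neg_cyc_reach_imp_path[of u v "\<lambda>_. 1"] by (auto simp: awalk_cost_unit)
  then show ?thesis by (auto simp: gdist_def awalk_cost_unit)
qed

lemma gdist_arc_le:
  assumes "(u, w) \<in> parcs G" "gdist G w v < \<infinity>"
  shows "gdist G u v \<le> gdist G w v + 1"
proof -
  have "w \<rightarrow>\<^sup>*\<^bsub>with_proj G\<^esub> v"
    using assms by (simp only: gdist_def \<mu>_reach_conv)
  then obtain p where p: "apath w p v" "\<mu> (\<lambda>_. 1) w v = awalk_cost (\<lambda>_. 1) p"
    using no_neg_cyc_reach_imp_path[of w v "\<lambda>_. 1"] by (auto simp: awalk_cost_unit)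
  then have "awalk u ((u, w) # p) v"
    using assms(1) by (auto simp: awalk_Cons_iff awalkI_apath)
  from min_cost_le_walk_cost[OF this, of "\<lambda>_. 1"] p(2) show ?thesis
    by (simp add: gdist_def awalk_cost_unit add.commute)
qed

lemma threshold_dim_le_metric_dim:
  assumes "pair_graph H" "pverts H = pverts G" "parcs G \<subseteq> parcs H"
  shows "threshold_dim G \<le> metric_dim H"
proof -
  interpret H: pair_graph H by fact
  have "spanning (with_proj G) (with_proj H)"
    using assms(2,3) wf_digraph_axioms H.wf_digraph_axioms
    by (auto simp: spanning_def subgraph_def compatible_def)
  then show ?thesis
    unfolding threshold_dim_def using assms(1) by (intro Least_le) blast
qed

text \<open>The construction for an arbitrary \<open>W\<close>: with at most \<open>k\<close>
  neighbours in \<open>W\<close>, each outside vertex has at least \<open>2 ^ (card W - k)\<close>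
  candidate neighbourhoods, enough for an injective choice.\<close>

lemma threshold_dim_le_card:
  assumes W: "W \<subseteq> pverts G"
    and deg: "\<And>a. a \<in> pverts G - W \<Longrightarrow> card {w\<in>W. (a, w) \<in> parcs G} \<le> k"
    and card: "card (pverts G - W) \<le> 2 ^ (card W - k)"
  shows "threshold_dim G \<le> card W"
proof -
  define N where "N a = {w\<in>W. (a, w) \<in> parcs G}" for a
  have finW: "finite W"
    using W pair_finite_verts finite_subset by blast
  have "card (pverts G - W) \<le> card {S. N a \<subseteq> S \<and> S \<subseteq> W}" if "a \<in> pverts G - W" for a
  proof -
    have "(2::nat) ^ (card W - k) \<le> 2 ^ (card W - card (N a))"
      using deg[OF that] by (intro power_increasing diff_le_mono2) (auto simp: N_def)
    also have "\<dots> = card {S. N a \<subseteq> S \<and> S \<subseteq> W}"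
      using finW by (intro card_supersets[symmetric]) (auto simp: N_def)
    finally show ?thesis using card by (rule order_trans[rotated])
  qed
  then have "\<exists>S. inj_on S (pverts G - W) \<and> (\<forall>a\<in>pverts G - W. S a \<in> {S. N a \<subseteq> S \<and> S \<subseteq> W})"
    using pair_finite_verts finW by (intro inj_choice_if_card_le) auto
  then obtain S where S: "inj_on S (pverts G - W)"
    "\<And>a. a \<in> pverts G - W \<Longrightarrow> N a \<subseteq> S a" "\<And>a. a \<in> pverts G - W \<Longrightarrow> S a \<subseteq> W"
    by blast
  define E where "E = Sigma (pverts G - W) S"
  define H where "H = \<lparr>pverts = pverts G, parcs = parcs G \<union> E \<union> E\<inverse>\<rparr>"
  have E_sub: "E \<subseteq> (pverts G - W) \<times> W"
    using S(3) by (auto simp: E_def)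
  have "finite E"
    using E_sub finW pair_finite_verts by (meson finite_Diff finite_SigmaI finite_subset)
  have "symmetric H"
    using pair_sym_arcs by (auto simp: symmetric_def H_def sym_def)
  interpret H: pair_graph H
  proof
    show "fst e \<in> pverts H" "snd e \<in> pverts H" if "e \<in> parcs H" for e
      using that subsetD[OF E_sub] subsetD[OF W] by (cases e; fastforce simp: H_def dest: wellformed')+
    show "fst e \<noteq> snd e" if "e \<in> parcs H" for e
      using that subsetD[OF E_sub] pair_no_loops by (cases e; fastforce simp: H_def)
  qed (use \<open>finite E\<close> \<open>symmetric H\<close> pair_finite_verts pair_finite_arcs in \<open>auto simp: H_def\<close>)
  \<comment> \<open>Old arcs from \<open>a\<close> into \<open>W\<close> end in
    \<open>N a \<subseteq> S a\<close>, and the arcs of \<open>E\<inverse>\<close> start in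
    \<open>W\<close>, so \<open>S a\<close> is the entire neighbourhood of \<open>a\<close> in
    \<open>W\<close>.\<close>
  have arc_iff: "(a, w) \<in> parcs H \<longleftrightarrow> w \<in> S a" if "a \<in> pverts G - W" "w \<in> W" for a w
    using that E_sub S(2)[OF that(1)] by (auto simp: H_def E_def N_def)
  have "\<exists>w\<in>W. resolves H w a b" if ab: "a \<in> pverts H" "b \<in> pverts H" "a \<noteq> b" for a b
  proof (cases "a \<in> W \<or> b \<in> W")
    case True
    \<comment> \<open>A vertex is at distance 0 from itself and at least 1 from any other, so a
      member of \<open>W\<close> resolves every pair containing it.\<close>
    moreover have "resolves H a a b" "resolves H b a b"
      using ab gdist_self[OF H.pair_graph_axioms] gdist_neq_ge_1[OF H.pair_graph_axioms, of a b]
        gdist_neq_ge_1[OF H.pair_graph_axioms, of b a]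
      by (auto simp: resolves_def)
    ultimately show ?thesis by blast
  next
    case False
    then have out: "a \<in> pverts G - W" "b \<in> pverts G - W"
      using ab by (auto simp: H_def)
    then have "S a \<noteq> S b"
      using S(1) ab(3) by (auto dest: inj_onD)
    then obtain w where w: "w \<in> W" "(w \<in> S a) \<noteq> (w \<in> S b)"
      using S(3) out by blast
    \<comment> \<open>Exactly one of the two distances is 1; the value of the other is
      irrelevant.\<close>
    then have "(gdist H a w = 1) \<noteq> (gdist H b w = 1)"
      using False out by (metis H.gdist_eq_1_iff arc_iff)
    then have "resolves H w a b" by (metis resolves_def)
    then show ?thesis using w(1) by blast
  qed
  then have "resolving_set H W"
    using W by (auto simp: resolving_set_def H_def)
  then have "metric_dim H \<le> card W"
    unfolding metric_dim_def by (intro Least_le) blast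
  moreover have "threshold_dim G \<le> metric_dim H"
    by (rule threshold_dim_le_metric_dim) (unfold_locales, auto simp: H_def)
  ultimately show ?thesis by simp
qed

end

theorem corollary3p2:
  fixes G :: "'a pair_pre_digraph" and n d :: nat
  assumes "pair_graph G"
    and "Digraph_Component.connected (with_proj G)"
    and "card (pverts G) = n"
    and "gdiameter G = ereal (real d)"
    and "(2::real) powi (int d - 3) \<ge> real n - real d"
  shows "threshold_dim G \<le> d"
proof -
  interpret pair_graph G by fact
  define D where "D = {gdist G u v | u v. u \<in> pverts G \<and> v \<in> pverts G}"
  have "D = (\<lambda>(u, v). gdist G u v) ` (pverts G \<times> pverts G)"
    by (auto simp: D_def)
  then have finD: "finite D"
    using pair_finite_verts by simp
  have "pverts G \<noteq> {}"
    using assms(2) by (auto simp: connected_def strongly_connected_def)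
  then have "D \<noteq> {}" by (auto simp: D_def)
  have Max_D: "Max D = ereal (real d)"
    using assms(4) by (simp add: gdiameter_def D_def)
  then have "ereal (real d) \<in> D"
    using Max_in[OF finD \<open>D \<noteq> {}\<close>] by simp
  then obtain u v where uv: "u \<in> pverts G" "v \<in> pverts G" "gdist G u v = ereal (real d)"
    by (auto simp: D_def)
  have fin_dist: "gdist G a v < \<infinity>" if "a \<in> pverts G" for a
  proof -
    have "gdist G a v \<le> ereal (real d)"
      using Max_ge[OF finD, of "gdist G a v"] that uv(2) Max_D by (auto simp: D_def)
    then show ?thesis by (rule order_le_less_trans) simp
  qed
  then have "\<forall>a\<in>pverts G. \<exists>k::nat. gdist G a v = ereal (real k)"
    using gdist_nat by blast
  from bchoice[OF this] obtain lev
    where lev: "\<And>a. a \<in> pverts G \<Longrightarrow> gdist G a v = ereal (real (lev a))"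
    by blast
  have lev_arc: "lev a \<le> lev b + 1" if "(a, b) \<in> parcs G" for a b
    using gdist_arc_le[OF that fin_dist] lev that
    by (simp add: in_arcsD1[OF that] in_arcsD2[OF that] one_ereal_def)
  \<comment> \<open>A discrete intermediate value argument: along a walk to \<open>v\<close> the
    level ends at 0 and drops by at most one per arc, so no value below the initial level is
    skipped.\<close>
  have ex_lev: "\<exists>w\<in>pverts G. lev w = i" if "awalk a p v" "i \<le> lev a" for a p i
    using that
  proof (induction p arbitrary: a)
    case Nil
    then show ?case
      using lev[of v] gdist_self[OF assms(1), of v] uv(2)
      by (auto simp: awalk_Nil_iff zero_ereal_def)
  next
    case (Cons e p)
    then have e: "(a, snd e) \<in> parcs G" "awalk (snd e) p v"
      by (auto simp: awalk_Cons_iff)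
    show ?case
    proof (cases "i \<le> lev (snd e)")
      case True
      then show ?thesis using Cons.IH e(2) by blast
    next
      case False
      then have "i = lev a" using lev_arc[OF e(1)] Cons.prems(2) by simp
      then show ?thesis using in_arcsD1[OF e(1)] by blast
    qed
  qed
  have "u \<rightarrow>\<^sup>*\<^bsub>with_proj G\<^esub> v"
    using fin_dist[OF uv(1)] by (simp only: gdist_def \<mu>_reach_conv)
  then obtain p where "awalk u p v" by (auto simp: reachable_awalk)
  moreover have "lev u = d" using lev[OF uv(1)] uv(3) by simp
  ultimately have "\<exists>w\<in>pverts G. lev w = i" if "i \<le> d" for i
    using ex_lev that by blast
  then obtain w where w: "\<And>i. i \<le> d \<Longrightarrow> w i \<in> pverts G \<and> lev (w i) = i"
    by metis
  \<comment> \<open>Level \<open>d\<close> is left out: this gives exactly \<open>d\<close> vertices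
    and keeps \<open>w d\<close> outside \<open>W\<close>, which will yield
    \<open>d < n\<close>.\<close>
  define W where "W = w ` {..<d}"
  have W: "W \<subseteq> pverts G" "inj_on lev W" "card W = d"
  proof -
    show "W \<subseteq> pverts G" "inj_on lev W"
      using w by (auto simp: W_def inj_on_def)
    have "inj_on w {..<d}"
      using w by (metis inj_onI lessThan_iff less_imp_le)
    then show "card W = d"
      by (simp add: W_def card_image)
  qed
  have finW: "finite W"
    by (simp add: W_def)
  have "w d \<noteq> w i" if "i < d" for i
    using w[of d] w[of i] that by auto
  then have "w d \<in> pverts G - W"
    using w[of d] by (auto simp: W_def)
  then have "W \<subset> pverts G"
    using W(1) by blast
  then have "d < n"
    using psubset_card_mono[OF pair_finite_verts] assms(3) W(3) by metis
  \<comment> \<open>For \<open>d < 3\<close> the integer power would be below 1, while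
    \<open>n - d\<close> is at least 1. Hence \<open>3 \<le> d\<close>, and the natural exponent
    \<open>d - 3\<close> involves no truncation.\<close>
  then have "(1::real) \<le> 2 powi (int d - 3)"
    using assms(5) by linarith
  then have "3 \<le> d"
    using power_int_strict_increasing[of "int d - 3" 0 "2::real"] by force
  then have "(2::real) powi (int d - 3) = 2 ^ (d - 3)"
    by (simp add: power_int_def nat_diff_distrib)
  then have "real (n - d) \<le> real (2 ^ (d - 3))"
    using assms(5) \<open>d < n\<close> by simp
  then have "card (pverts G - W) \<le> 2 ^ (card W - 3)"
    using W assms(3) finW by (simp only: of_nat_le_iff card_Diff_subset)
  moreover have "card {b\<in>W. (a, b) \<in> parcs G} \<le> 3" for a
  proof -
    \<comment> \<open>Symmetry of the arcs bounds the level change in both directions, leaving three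
      possible levels; truncation at level 0 only shrinks this window. As \<open>lev\<close> is
      injective on \<open>W\<close>, each level accounts for at most one neighbour.\<close>
    have "lev ` {b\<in>W. (a, b) \<in> parcs G} \<subseteq> {lev a - 1..lev a + 1}"
    proof
      fix i assume "i \<in> lev ` {b\<in>W. (a, b) \<in> parcs G}"
      then obtain b where b: "i = lev b" "(a, b) \<in> parcs G"
        by auto
      then show "i \<in> {lev a - 1..lev a + 1}"
        using lev_arc[of a b] lev_arc[of b a] arcs_symmetric by auto
    qed
    from card_mono[OF _ this] have "card (lev ` {b\<in>W. (a, b) \<in> parcs G}) \<le> 3"
      by simp
    moreover have "inj_on lev {b\<in>W. (a, b) \<in> parcs G}"
      using W(2) by (rule inj_on_subset) auto
    ultimately show ?thesis by (simp add: card_image)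
  qed
  ultimately show ?thesis
    using threshold_dim_le_card[OF W(1), of 3] W(3) by simp
qed

end
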